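(* Let $N\ge 1$ and $n=\lceil N/3\rceil$, and let $j=e^{2i\pi/3}$. The transfer matrix $\mathbb R_N$ has size $2^{\lceil N/2\rceil}$. If $N\equiv 1\pmod 3$, then $\mathbb R_N$ is nilpotent (all its eigenvalues are $0$). Otherwise, the eigenvalues of $\mathbb R_N$ are: \begin{itemize} \item $0$ with multiplicity $2^{\lceil N/2\rceil}-2^n$, \item $1$ with multiplicity $(2^n+2(-1)^n)/3$, \item $j$ and $j^2$, each with multiplicity $(2^n-(-1)^n)/3$. \end{itemize}
   Context: The square complex matrix $\mathbb R_N$ has rows and columns indexed by the subsets of $\{1,2,\ldots,\lceil N/2\rceil\}$. For $C,D\subseteq\{1,\ldots,\lceil N/2\rceil\}$, $$\mathbb R_N(C,D)=\begin{cases} i^{|C|+|D|} & \text{if } \{1,2,\ldots,\lfloor N/2\rfloor\}\subseteq C\cup D\cup(C-1)\cup(D-1),\\ 0&\text{otherwise,}\end{cases}$$ where $i$ is the imaginary unit and $C-1=\{c-1: c\in C\}$. Equivalently, $\mathbb R_N=\mathbb P_N\mathbb P_N^{T}$, where $\mathbb P_N$ is the matrix with rows indexed by subsets $C$ of $\{1,\ldots,\lceil N/2\rceil\}$, columns indexed by subsets $D$ of $\{1,\ldots,\lfloor N/2\rfloor\}$, and $\mathbb P_N(C,D)=i^{|C|+|D|}$ if $C\cap D=C\cap(D+1)=\emptyset$, and $\mathbb P_N(C,D)=0$ otherwise, with $D+1=\{d+1:d\in D\}$. Multiplicities are algebraic multiplicities (as roots of the characteristic polynomial); multiplicity $0$ means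 that the number is not an eigenvalue. *)

theory Defs
  imports
    Complex_Main
    "HOL-Library.Nat_Bijection"
    "Jordan_Normal_Form.Char_Poly"
begin

text \<open>
  Matrices of the Jordan normal form library are indexed by natural numbers, so the subsets of
  \<open>{1..m}\<close> are enumerated by the numbers below \<open>2 ^ m\<close> through their binary digits: \<open>c\<close> belongs to
  the subset with number \<open>k\<close> iff the digit of weight \<open>2 ^ (c - 1)\<close> of \<open>k\<close> is 1.
\<close>

definition subset_of :: "nat \<Rightarrow> nat set" where
  "subset_of k = Suc ` set_decode k"

lemma bij_betw_subset_of: "bij_betw subset_of {..<2 ^ m} (Pow {1..m})"
proof -
  have 1: "bij_betw set_decode {..<2 ^ m} (Pow {..<m})"
  proof (rule bij_betw_byWitness[where f' = set_encode])
    show "\<forall>k\<in>{..<2 ^ m}. set_encode (set_decode k) = k" by simp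
    show "\<forall>A\<in>Pow {..<m}. set_decode (set_encode A) = A"
      by (metis PowD finite_lessThan finite_subset set_encode_inverse)
    show "set_decode ` {..<2 ^ m} \<subseteq> Pow {..<m}"
    proof clarsimp
      fix k x :: nat
      assume "k < 2 ^ m" and x: "x \<in> set_decode k"
      show "x < m"
      proof (rule ccontr)
        assume "\<not> x < m"
        then have "(2::nat) ^ m \<le> 2 ^ x" by simp
        with \<open>k < 2 ^ m\<close> have "k < 2 ^ x" by (rule less_le_trans)
        then have "k div 2 ^ x = 0" by (rule div_less)
        with x show False by (simp add: set_decode_def)
      qed
    qed
    show "set_encode ` Pow {..<m} \<subseteq> {..<2 ^ m}"
    proof clarsimp
      fix A :: "nat set"
      assume "A \<subseteq> {..<m}"
      then have "set_encode A \<le> (\<Sum>i<m. 2 ^ i)"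
        unfolding set_encode_def by (intro sum_mono2) auto
      also have "\<dots> < 2 ^ m"
        by (induction m) auto
      finally show "set_encode A < 2 ^ m" .
    qed
  qed
  have "bij_betw ((`) Suc) (Pow {..<m}) (Pow {1..m})"
    by (rule bij_betw_Pow) (simp add: bij_betw_def image_Suc_lessThan)
  with 1 have "bij_betw ((`) Suc \<circ> set_decode) {..<2 ^ m} (Pow {1..m})"
    by (rule bij_betw_trans)
  then show ?thesis
    by (simp add: subset_of_def comp_def cong: bij_betw_cong)
qed

definition R_entry :: "nat \<Rightarrow> nat set \<Rightarrow> nat set \<Rightarrow> complex" where
  "R_entry N C D =
    (if {1..nat \<lfloor>real N / 2\<rfloor>} \<subseteq> C \<union> D \<union> (\<lambda>c. c - 1) ` C \<union> (\<lambda>d. d - 1) ` D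
     then \<i> ^ (card C + card D) else 0)"

definition R_mat :: "nat \<Rightarrow> complex mat" where
  "R_mat N =
    (let s = 2 ^ nat \<lceil>real N / 2\<rceil>
     in mat s s (\<lambda>(k, l). R_entry N (subset_of k) (subset_of l)))"

end

theory Submission
  imports Defs "Jordan_Normal_Form.Jordan_Normal_Form_Existence"
begin

text \<open>
  An entry of \<open>R_N\<close> at \<open>C\<close>, \<open>D\<close> is \<open>\<i> ^ (|C| + |D|)\<close> if every \<open>d\<close> in \<open>{1..N div 2}\<close> is
  covered, that is, if \<open>d\<close> or \<open>d + 1\<close> belongs to \<open>C \<union> D\<close>. Two facts determine the spectrum.

  First, if adding \<open>p\<close> to \<open>C\<close> has no influence on the covering condition, then the rows (and the
  columns) of \<open>C\<close> and \<open>C \<union> {p}\<close> differ by the factor \<open>\<i>\<close>. Because \<open>1 + \<i>\<^sup>2 = 0\<close>, the vector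
  belonging to such a pair is isotropic and lies in the kernel, and both indices can be deleted at the
  price of a factor \<open>x\<^sup>2\<close> of the characteristic polynomial (\<open>set_char_poly_isotropic_pair\<close>). With
  \<open>p = 1\<close> this removes all index sets that contain 2, since 2 covers everything that 1 covers.

  Second, if some \<open>d\<close> can be covered only by \<open>p\<close>, then the matrix is the Kronecker product of
  \<open>[[0, \<i>], [\<i>, -1]]\<close>, whose eigenvalues are the primitive cube roots of unity, with the covering
  matrix from which \<open>p\<close> and all that it covers have been removed (\<open>poly_cover_char_poly_peel\<close>). After
  the removal of 2 this applies to \<open>p = d = 1\<close>, and then to \<open>p = 3\<close>, \<open>d = 2\<close>. What is left lives
  on the elements from 4 on and is \<open>R_(N-6)\<close>, up to a shift (\<open>root_pattern_cover_step\<close>).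

  So, apart from eigenvalues 0, passing from \<open>N - 6\<close> to \<open>N\<close> multiplies the spectrum twice by the
  two primitive cube roots of unity. One such multiplication turns the multiplicities \<open>u\<close> of 1 and
  \<open>v\<close> of each primitive cube root into \<open>2 v\<close> and \<open>u + v\<close>. Starting from the identity matrix of
  size 1, \<open>n\<close> multiplications give the multiplicities of the theorem. The sizes \<open>N \<le> 4\<close> are treated by
  the same means. For \<open>N = 1\<close> there is nothing to cover and all index sets cancel in pairs; for
  \<open>N = 4\<close> the element 2, which has to be covered, cannot be covered any more once it has been removed
  from the index sets. So the characteristic polynomial is a power of \<open>x\<close> in both cases, and hence in
  the whole residue class of 1 modulo 3.
\<close>

section \<open>Characteristic polynomials of matrices indexed by finite sets\<close>

definition list_mat :: "'a list \<Rightarrow> ('a \<Rightarrow> 'a \<Rightarrow> 'b) \<Rightarrow> 'b mat" where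
  "list_mat xs f = mat (length xs) (length xs) (\<lambda>(k, l). f (xs ! k) (xs ! l))"

lemma list_mat_carrier [simp]: "list_mat xs f \<in> carrier_mat (length xs) (length xs)"
  by (simp add: list_mat_def)

lemma list_mat_dim [simp]:
  "dim_row (list_mat xs f) = length xs" "dim_col (list_mat xs f) = length xs"
  by (simp_all add: list_mat_def)

lemma list_mat_index [simp]:
  "k < length xs \<Longrightarrow> l < length xs \<Longrightarrow> list_mat xs f $$ (k, l) = f (xs ! k) (xs ! l)"
  by (simp add: list_mat_def)

lemma list_mat_map: "list_mat (map g xs) f = list_mat xs (\<lambda>x y. f (g x) (g y))"
  by (rule eq_matI) auto

lemma det_permute_rows_cols:
  fixes A :: "'a :: comm_ring_1 mat"
  assumes A: "A \<in> carrier_mat n n" and p: "p permutes {0..<n}"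
  shows "det (mat n n (\<lambda>(i, j). A $$ (p i, p j))) = det A"
proof -
  let ?B = "mat n n (\<lambda>(i, j). A $$ (p i, j))"
  have lt: "p i < n" if "i < n" for i
    using permutes_in_image[OF p, of i] that by simp
  have B: "transpose_mat ?B \<in> carrier_mat n n" by simp
  have "mat n n (\<lambda>(i, j). A $$ (p i, p j)) =
      transpose_mat (mat n n (\<lambda>(i, j). transpose_mat ?B $$ (p i, j)))"
    by (rule eq_matI) (auto simp: lt)
  then have "det (mat n n (\<lambda>(i, j). A $$ (p i, p j))) =
      det (mat n n (\<lambda>(i, j). transpose_mat ?B $$ (p i, j)))"
    by (simp add: det_transpose[of _ n])
  also have "\<dots> = signof p * det (transpose_mat ?B)"
    by (rule det_permute_rows[OF B p])
  also have "det (transpose_mat ?B) = det ?B"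
    by (rule det_transpose[of _ n]) simp
  also have "det ?B = signof p * det A"
    by (rule det_permute_rows[OF A p])
  finally show ?thesis
    by (cases p rule: sign_cases) simp_all
qed

text \<open>
  Reordering an index list conjugates the matrix by a permutation matrix, so the characteristic
  polynomial depends only on the set of indices. The index set can then be cut into pieces and
  enumerated in whatever order puts the matrix into a convenient block form.
\<close>
lemma char_poly_list_mat_mset:
  fixes f :: "'a \<Rightarrow> 'a \<Rightarrow> 'b :: comm_ring_1"
  assumes "mset xs = mset ys"
  shows "char_poly (list_mat xs f) = char_poly (list_mat ys f)"
proof -
  obtain p where p: "p permutes {..<length ys}" and xs: "permute_list p ys = xs"
    using assms by (rule mset_eq_permutation)
  define n where "n = length ys"
  have len: "length xs = n" using assms n_def by (metis mset_eq_length)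
  have p': "p permutes {0..<n}" using p by (simp add: n_def atLeast0LessThan)
  have lt: "p i < n" if "i < n" for i
    using permutes_in_image[OF p', of i] that by simp
  have nth: "xs ! i = ys ! p i" if "i < n" for i
    using permute_list_nth[OF p, of i] that xs by (simp add: n_def)
  have inj: "p i = p j \<longleftrightarrow> i = j" for i j
    using permutes_inj[OF p'] by (auto dest: injD)
  have "char_poly_matrix (list_mat xs f) =
      mat n n (\<lambda>(i, j). char_poly_matrix (list_mat ys f) $$ (p i, p j))"
    by (rule eq_matI)
       (auto simp: char_poly_matrix_def len n_def[symmetric] lt nth inj list_mat_def)
  moreover have "char_poly_matrix (list_mat ys f) \<in> carrier_mat n n"
    unfolding n_def by (rule char_poly_matrix_closed) simp
  ultimately show ?thesis
    by (simp add: char_poly_def det_permute_rows_cols[OF _ p'])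
qed

definition set_char_poly :: "'a set \<Rightarrow> ('a \<Rightarrow> 'a \<Rightarrow> complex) \<Rightarrow> complex poly" where
  "set_char_poly I f = char_poly (list_mat (SOME xs. distinct xs \<and> set xs = I) f)"

lemma set_char_poly_list:
  assumes "distinct xs"
  shows "set_char_poly (set xs) f = char_poly (list_mat xs f)"
proof -
  let ?ys = "SOME ys. distinct ys \<and> set ys = set xs"
  have "distinct ?ys \<and> set ?ys = set xs"
    by (rule someI[of _ xs]) (simp add: assms)
  then have "mset ?ys = mset xs"
    using assms set_eq_iff_mset_eq_distinct by blast
  then show ?thesis
    unfolding set_char_poly_def by (rule char_poly_list_mat_mset)
qed

lemma set_char_poly_image:
  assumes "finite I" "inj_on g I"
  shows "set_char_poly (g ` I) f = set_char_poly I (\<lambda>x y. f (g x) (g y))"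
proof -
  obtain xs where xs: "set xs = I" "distinct xs"
    using finite_distinct_list[OF assms(1)] by blast
  have "set_char_poly (set (map g xs)) f = char_poly (list_mat (map g xs) f)"
    using xs assms(2) by (intro set_char_poly_list) (simp add: distinct_map)
  also have "\<dots> = set_char_poly (set xs) (\<lambda>x y. f (g x) (g y))"
    by (simp add: list_mat_map set_char_poly_list[OF xs(2)])
  finally show ?thesis by (simp add: xs(1))
qed

lemma char_poly_zero_mat: "char_poly (0\<^sub>m n n :: 'a :: comm_ring_1 mat) = [:0, 1:] ^ n"
proof -
  have "upper_triangular (0\<^sub>m n n :: 'a mat)" by auto
  then have "char_poly (0\<^sub>m n n :: 'a mat) = (\<Prod>a\<leftarrow>diag_mat (0\<^sub>m n n). [:- a, 1:])"
    by (intro char_poly_upper_triangular[of _ n]) simp_all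
  also have "diag_mat (0\<^sub>m n n :: 'a mat) = replicate n 0"
    unfolding diag_mat_def by (rule nth_equalityI) simp_all
  finally show ?thesis by simp
qed

lemma set_char_poly_zero:
  assumes "finite I" "\<And>x y. x \<in> I \<Longrightarrow> y \<in> I \<Longrightarrow> f x y = 0"
  shows "set_char_poly I f = [:0, 1:] ^ card I"
proof -
  obtain xs where xs: "set xs = I" "distinct xs"
    using finite_distinct_list[OF assms(1)] by blast
  have "list_mat xs f = 0\<^sub>m (length xs) (length xs)"
    by (rule eq_matI) (use assms xs in auto)
  then have "set_char_poly I f = [:0, 1:] ^ length xs"
    using set_char_poly_list[OF xs(2), of f] xs by (simp add: char_poly_zero_mat)
  then show ?thesis
    using xs by (metis distinct_card)
qed

section \<open>Isotropic pairs and Kronecker products\<close>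

lemma char_poly_four_block_lower_left_zero:
  fixes A B D :: "'a :: idom mat"
  assumes "A \<in> carrier_mat n n" "B \<in> carrier_mat n m" "D \<in> carrier_mat m m"
  shows "char_poly (four_block_mat A B (0\<^sub>m m n) D) = char_poly A * char_poly D"
proof -
  have "char_poly_matrix (four_block_mat A B (0\<^sub>m m n) D) =
      four_block_mat (char_poly_matrix A) (map_mat (\<lambda>a. [:- a:]) B) (0\<^sub>m m n) (char_poly_matrix D)"
    by (rule eq_matI) (use assms in \<open>auto simp: char_poly_matrix_def one_poly_def\<close>)
  then show ?thesis
    unfolding char_poly_def using assms
    by (simp add: det_four_block_mat_lower_left_zero[of _ n _ m])
qed

text \<open>
  As \<open>c\<^sup>2 = -1\<close>, the vector \<open>v = e_a + c e_b\<close> is isotropic for the standard bilinear form. The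
  hypothesis on columns says that \<open>v\<close> lies in the kernel, the one on rows that the image is contained
  in the orthogonal complement of \<open>v\<close>. Modulo \<open>v\<close>, this complement is spanned by the remaining unit
  vectors, and the matrix acts on it as the submatrix without \<open>a\<close> and \<open>b\<close>; the two lost dimensions
  carry the eigenvalue 0.
\<close>
lemma set_char_poly_isotropic_pair:
  fixes c :: complex
  assumes fin: "finite I" and ab: "a \<in> I" "b \<in> I" "a \<noteq> b" and c: "c\<^sup>2 = -1"
    and row: "\<And>y. y \<in> I \<Longrightarrow> f b y = c * f a y"
    and col: "\<And>x. x \<in> I \<Longrightarrow> f x b = c * f x a"
  shows "set_char_poly I f = [:0, 1:]\<^sup>2 * set_char_poly (I - {a, b}) f"
proof -
  obtain rs where rs: "set rs = I - {a, b}" "distinct rs"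
    using finite_distinct_list[of "I - {a, b}"] fin by blast
  let ?n = "length rs"
  let ?xs = "a # rs @ [b]"
  let ?A = "list_mat ?xs f"
  \<comment> \<open>the change of basis that replaces \<open>e_a\<close> by \<open>e_a + c e_b\<close>: column \<open>a\<close> and row \<open>b\<close> become 0\<close>
  let ?B = "add_col_sub_row c (Suc ?n) 0 ?A"
  have dist: "distinct ?xs" and set: "set ?xs = I"
    using rs ab by auto
  have mem: "?xs ! k \<in> I" if "k < Suc (Suc ?n)" for k
    using nth_mem[of k ?xs] that unfolding set by simp
  have cc: "c * c = -1" using c by (simp add: power2_eq_square)
  have c3: "c * (c * z) = - z" for z
    using cc by (simp flip: mult.assoc)
  have simB: "char_poly ?A = char_poly ?B"
    by (rule char_poly_similar[OF similar_mat_sym[OF add_col_sub_row_similar[of _ "Suc (Suc ?n)"]]])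
       (use list_mat_carrier[of ?xs f] in auto)
  have idx: "?B $$ (k, l) =
      (if l = 0 \<or> k = Suc ?n then 0 else f (?xs ! k) (?xs ! l))"
    if kl: "k < Suc (Suc ?n)" "l < Suc (Suc ?n)" for k l
  proof -
    have *: "f b a = c * f a a" "f a b = c * f a a" "f b b = - f a a"
      using row[OF ab(1)] col[OF ab(1)] row[OF ab(2)] by (simp_all add: c3)
    have last: "?xs ! Suc ?n = b" by (simp add: nth_append)
    show ?thesis
      using kl row[OF mem[OF kl(2)]] col[OF mem[OF kl(1)]]
      by (subst add_col_sub_index_row)
         (auto simp: last * c3 cc simp del: nth_Cons_Suc append_Cons)
  qed
  have "?B = four_block_mat (0\<^sub>m 1 1) (mat 1 (Suc ?n) (\<lambda>(k, l). f a ((rs @ [b]) ! l)))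
      (0\<^sub>m (Suc ?n) 1)
      (four_block_mat (list_mat rs f) (mat ?n 1 (\<lambda>(k, l). f (rs ! k) b)) (0\<^sub>m 1 ?n) (0\<^sub>m 1 1))"
    (is "?B = four_block_mat ?B1 ?B2 ?B3 ?B4")
    by (rule eq_matI)
       (auto simp: idx nth_Cons' nth_append not_less Suc_diff_Suc less_Suc_eq simp del: add_col_sub_index_row,
        (cases rs; simp)+)
  then have "char_poly ?B = char_poly (four_block_mat ?B1 ?B2 ?B3 ?B4)"
    by (rule arg_cong)
  also have "\<dots> = char_poly ?B1 * char_poly ?B4"
    by (rule char_poly_four_block_lower_left_zero) auto
  also have "char_poly ?B4 = char_poly (list_mat rs f) * char_poly (0\<^sub>m 1 1)"
    by (rule char_poly_four_block_lower_left_zero[of _ ?n _ 1]) simp_all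
  finally have "char_poly ?A = [:0, 1:]\<^sup>2 * char_poly (list_mat rs f)"
    by (simp only: simB char_poly_zero_mat power_one_right power2_eq_square ac_simps)
  then show ?thesis
    using set_char_poly_list[OF dist, of f] set_char_poly_list[OF rs(2), of f]
    by (simp only: set rs)
qed

lemma set_char_poly_isotropic_pairs:
  fixes c :: complex
  assumes fin: "finite I" and A: "A \<subseteq> I" "\<tau> ` A \<subseteq> I" "\<tau> ` A \<inter> A = {}" "inj_on \<tau> A"
    and c: "c\<^sup>2 = -1"
    and row: "\<And>a y. a \<in> A \<Longrightarrow> y \<in> I \<Longrightarrow> f (\<tau> a) y = c * f a y"
    and col: "\<And>a x. a \<in> A \<Longrightarrow> x \<in> I \<Longrightarrow> f x (\<tau> a) = c * f x a"
  shows "set_char_poly I f = [:0, 1:] ^ (2 * card A) * set_char_poly (I - A - \<tau> ` A) f"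
proof -
  have "finite A" using fin A(1) finite_subset by blast
  then show ?thesis
    using A row col
  proof (induction A)
    case empty
    then show ?case by simp
  next
    case (insert a A)
    let ?J = "I - A - \<tau> ` A"
    have "set_char_poly I f = [:0, 1:] ^ (2 * card A) * set_char_poly ?J f"
      using insert.prems by (intro insert.IH) auto
    also have "set_char_poly ?J f = [:0, 1:]\<^sup>2 * set_char_poly (?J - {a, \<tau> a}) f"
      using insert.prems insert.hyps fin c
      by (intro set_char_poly_isotropic_pair[where c = c]) (auto simp: inj_on_def)
    also have "?J - {a, \<tau> a} = I - insert a A - \<tau> ` insert a A" by auto
    finally show ?case
      using insert.hyps by (simp add: power_add power2_eq_square ac_simps)
  qed
qed

lemma mult_affine_mat:
  fixes M :: "'a :: comm_ring_1 mat"
  assumes M: "M \<in> carrier_mat n n"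
  shows "(x \<cdot>\<^sub>m 1\<^sub>m n + a \<cdot>\<^sub>m M) * (y \<cdot>\<^sub>m 1\<^sub>m n + b \<cdot>\<^sub>m M) =
    (x * y) \<cdot>\<^sub>m 1\<^sub>m n + (x * b + a * y) \<cdot>\<^sub>m M + (a * b) \<cdot>\<^sub>m (M * M)"
proof -
  have "(x \<cdot>\<^sub>m 1\<^sub>m n + a \<cdot>\<^sub>m M) * (y \<cdot>\<^sub>m 1\<^sub>m n + b \<cdot>\<^sub>m M) =
    (x \<cdot>\<^sub>m 1\<^sub>m n * (y \<cdot>\<^sub>m 1\<^sub>m n) + a \<cdot>\<^sub>m M * (y \<cdot>\<^sub>m 1\<^sub>m n)) +
    (x \<cdot>\<^sub>m 1\<^sub>m n * (b \<cdot>\<^sub>m M) + a \<cdot>\<^sub>m M * (b \<cdot>\<^sub>m M))"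
    using M by (simp add: mult_add_distrib_mat[of _ n n _ n] add_mult_distrib_mat[of _ n n _ _ n])
  also have "\<dots> = (x * y) \<cdot>\<^sub>m 1\<^sub>m n + (x * b + a * y) \<cdot>\<^sub>m M + (a * b) \<cdot>\<^sub>m (M * M)"
    using M by (simp add: mult_smult_assoc_mat[of _ n n _ n] mult_smult_distrib[of _ n n _ n])
               (rule eq_matI, auto simp: algebra_simps)
  finally show ?thesis .
qed

lemma poly_char_poly:
  fixes A :: "'a :: field mat"
  assumes "A \<in> carrier_mat n n"
  shows "poly (char_poly A) x = det (x \<cdot>\<^sub>m 1\<^sub>m n + (-1) \<cdot>\<^sub>m A)"
proof -
  have "- char_matrix A x = x \<cdot>\<^sub>m 1\<^sub>m n + (-1) \<cdot>\<^sub>m A"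
    using assms by (intro eq_matI) (auto simp: char_matrix_def)
  then show ?thesis by (simp add: char_poly_matrix[OF assms])
qed

text \<open>
  The last three identities compute the products \<open>q(\<omega> x) q(\<omega>\<^sup>2 x)\<close> for \<open>q(x)\<close> one of \<open>x\<close>,
  \<open>x - 1\<close>, \<open>x\<^sup>2 + x + 1\<close>, the only factors that occur in the characteristic polynomials below. The
  right-hand sides are again products of these factors.
\<close>
lemma cube_root_of_unity_norms:
  fixes \<omega> x :: "'a :: comm_ring_1"
  assumes \<omega>: "\<omega>\<^sup>2 + \<omega> + 1 = 0"
  shows "\<omega> * x + \<omega>\<^sup>2 * x = - x"
    "(\<omega> * x) * (\<omega>\<^sup>2 * x) = x\<^sup>2"
    "(\<omega> * x - 1) * (\<omega>\<^sup>2 * x - 1) = 1 + x * (1 + x)"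
    "(1 + \<omega> * x * (1 + \<omega> * x)) * (1 + \<omega>\<^sup>2 * x * (1 + \<omega>\<^sup>2 * x)) =
      (x - 1)\<^sup>2 * (1 + x * (1 + x))"
proof -
  \<comment> \<open>each identity is a consequence of \<open>\<omega>\<^sup>2 + \<omega> + 1 = 0\<close> with an explicit cofactor \<open>q\<close>\<close>
  have eq: "a = b" if "a - b = (\<omega>\<^sup>2 + \<omega> + 1) * q" for a b q
    using that \<omega> by simp
  show "\<omega> * x + \<omega>\<^sup>2 * x = - x"
    by (rule eq[of _ _ x]) (simp add: algebra_simps)
  show "(\<omega> * x) * (\<omega>\<^sup>2 * x) = x\<^sup>2"
    by (rule eq[of _ _ "\<omega> * x^2 - x^2"]) (simp add: algebra_simps power2_eq_square)
  show "(\<omega> * x - 1) * (\<omega>\<^sup>2 * x - 1) = 1 + x * (1 + x)"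
    by (rule eq[of _ _ "\<omega> * x^2 - x^2 - x"]) (simp add: algebra_simps power2_eq_square)
  show "(1 + \<omega> * x * (1 + \<omega> * x)) * (1 + \<omega>\<^sup>2 * x * (1 + \<omega>\<^sup>2 * x)) = (x - 1)\<^sup>2 * (1 + x * (1 + x))"
    by (rule eq[of _ _ "\<omega>^4 * x^4 - \<omega>^3 * x^4 + \<omega>^3 * x^3 + \<omega>^2 * x^2 + \<omega> * x^4 - \<omega> * x^3 - x^4 + x^3 + x"])
       (simp add: algebra_simps power2_eq_square power3_eq_cube power4_eq_xxxx)
qed

text \<open>
  The matrix \<open>f\<close> is the Kronecker product of \<open>[[0, \<i>], [\<i>, -1]]\<close> with \<open>g\<close>. The first factor
  has characteristic polynomial \<open>x\<^sup>2 + x + 1\<close>, hence the eigenvalues \<open>\<omega>\<close> and \<open>\<omega>\<^sup>2\<close>, so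
  the eigenvalues of \<open>f\<close> are those of \<open>g\<close> multiplied by \<open>\<omega>\<close> and by \<open>\<omega>\<^sup>2\<close>. This is the
  corresponding identity of characteristic polynomials, because \<open>\<omega> \<cdot> \<omega>\<^sup>2 = 1\<close>.
\<close>
lemma poly_set_char_poly_kronecker:
  fixes \<omega> :: complex
  assumes \<omega>: "\<omega>\<^sup>2 + \<omega> + 1 = 0" and fin: "finite J"
    and \<tau>: "inj_on \<tau> J" "J \<inter> \<tau> ` J = {}"
    and f: "\<And>a b. a \<in> J \<Longrightarrow> b \<in> J \<Longrightarrow> f a b = 0"
      "\<And>a b. a \<in> J \<Longrightarrow> b \<in> J \<Longrightarrow> f a (\<tau> b) = \<i> * g a b"
      "\<And>a b. a \<in> J \<Longrightarrow> b \<in> J \<Longrightarrow> f (\<tau> a) b = \<i> * g a b"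
      "\<And>a b. a \<in> J \<Longrightarrow> b \<in> J \<Longrightarrow> f (\<tau> a) (\<tau> b) = - g a b"
  shows "poly (set_char_poly (J \<union> \<tau> ` J) f) x =
    poly (set_char_poly J g) (\<omega> * x) * poly (set_char_poly J g) (\<omega>\<^sup>2 * x)"
proof -
  obtain xs where xs: "set xs = J" "distinct xs"
    using finite_distinct_list[OF fin] by blast
  define n where "n = length xs"
  define M where "M = list_mat xs g"
  let ?ys = "xs @ map \<tau> xs"
  let ?A = "list_mat ?ys f"
  have M: "M \<in> carrier_mat n n" by (simp add: M_def n_def)
  have A: "?A \<in> carrier_mat (n + n) (n + n)"
    using list_mat_carrier[of ?ys f] by (simp add: n_def)
  have mem: "xs ! k \<in> J" if "k < n" for k
    using that xs by (auto simp: n_def)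
  have dist: "distinct ?ys" and set: "set ?ys = J \<union> \<tau> ` J"
    using xs \<tau> by (auto simp: distinct_map)
  have block: "x \<cdot>\<^sub>m 1\<^sub>m (n + n) + (-1) \<cdot>\<^sub>m ?A =
      four_block_mat (x \<cdot>\<^sub>m 1\<^sub>m n + 0 \<cdot>\<^sub>m M) (0 \<cdot>\<^sub>m 1\<^sub>m n + (- \<i>) \<cdot>\<^sub>m M)
        (0 \<cdot>\<^sub>m 1\<^sub>m n + (- \<i>) \<cdot>\<^sub>m M) (x \<cdot>\<^sub>m 1\<^sub>m n + 1 \<cdot>\<^sub>m M)"
    (is "_ = four_block_mat ?P ?Q ?Q ?S")
    using M
    by (intro eq_matI)
       (auto simp: list_mat_def M_def n_def[symmetric] nth_append f mem)
  have "poly (char_poly ?A) x = det (?P * ?S - ?Q * ?Q)"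
    unfolding poly_char_poly[OF A] block
    by (rule det_four_block_mat[of _ n]) (use M in \<open>simp_all only: mult_affine_mat[OF M], simp_all add: mult.commute\<close>)
  also have "?P * ?S - ?Q * ?Q = x\<^sup>2 \<cdot>\<^sub>m 1\<^sub>m n + x \<cdot>\<^sub>m M + M * M"
    unfolding mult_affine_mat[OF M]
    using M by (intro eq_matI) (auto simp: power2_eq_square)
  \<comment> \<open>the factorization \<open>x\<^sup>2 + x m + m\<^sup>2 = (\<omega> x - m) (\<omega>\<^sup>2 x - m)\<close>\<close>
  also have "\<dots> = ((\<omega> * x) \<cdot>\<^sub>m 1\<^sub>m n + (-1) \<cdot>\<^sub>m M) * ((\<omega>\<^sup>2 * x) \<cdot>\<^sub>m 1\<^sub>m n + (-1) \<cdot>\<^sub>m M)"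
  proof -
    have "(\<omega> * x) * -1 + -1 * (\<omega>\<^sup>2 * x) = x"
      using cube_root_of_unity_norms(1)[OF \<omega>, of "- x"] by simp
    then show ?thesis
      unfolding mult_affine_mat[OF M] cube_root_of_unity_norms(2)[OF \<omega>]
      using M by (intro eq_matI) auto
  qed
  also have "det \<dots> = poly (char_poly M) (\<omega> * x) * poly (char_poly M) (\<omega>\<^sup>2 * x)"
    unfolding poly_char_poly[OF M] by (rule det_mult[of _ n]) (use M in auto)
  finally show ?thesis
    using set_char_poly_list[OF dist, of f] set_char_poly_list[OF xs(2), of g]
    unfolding set xs M_def by simp
qed

section \<open>Covering matrices\<close>

text \<open>
  The set \<open>K\<close> of elements to be covered is arbitrary, because peeling elements off the left end
  of \<open>{1..N div 2}\<close> leads to sets of another form. The matrix of the theorem has \<open>X = C \<union> D\<close>.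
\<close>
definition covers :: "nat set \<Rightarrow> nat set \<Rightarrow> bool" where
  "covers K X \<longleftrightarrow> (\<forall>d\<in>K. d \<in> X \<or> Suc d \<in> X)"

definition cover_entry :: "nat set \<Rightarrow> nat set \<Rightarrow> nat set \<Rightarrow> complex" where
  "cover_entry K C D = (if covers K (C \<union> D) then \<i> ^ (card C + card D) else 0)"

definition cover_char_poly :: "nat set \<Rightarrow> nat set \<Rightarrow> complex poly" where
  "cover_char_poly S K = set_char_poly (Pow S) (cover_entry K)"

text \<open>
  The element \<open>p\<close> covers only \<open>p\<close> and \<open>p - 1\<close>. If \<open>C\<close> covers both already, as far as they belong
  to \<open>K\<close>, then adding \<open>p\<close> to \<open>C\<close> changes nothing but the cardinality.
\<close>
lemma cover_entry_insert_covered: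
  assumes fin: "finite C" and p: "p \<notin> C"
    and cov: "\<And>d. d \<in> K \<Longrightarrow> d = p \<or> Suc d = p \<Longrightarrow> d \<in> C \<or> Suc d \<in> C"
  shows "cover_entry K (insert p C) D = \<i> * cover_entry K C D"
    "cover_entry K D (insert p C) = \<i> * cover_entry K D C"
proof -
  have "covers K (insert p (C \<union> D)) \<longleftrightarrow> covers K (C \<union> D)"
    "covers K (insert p (D \<union> C)) \<longleftrightarrow> covers K (D \<union> C)"
    unfolding covers_def using cov by blast+
  then show "cover_entry K (insert p C) D = \<i> * cover_entry K C D"
    "cover_entry K D (insert p C) = \<i> * cover_entry K D C"
    using fin p by (simp_all add: cover_entry_def)
qed

text \<open>
  For such sets \<open>C\<close> the indices \<open>C\<close> and \<open>insert p C\<close> form a pair as in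
  \<open>set_char_poly_isotropic_pairs\<close>, with \<open>c = \<i>\<close>.
\<close>
lemma cover_char_poly_reduce:
  assumes fin: "finite S" and p: "p \<in> S" and A: "A \<subseteq> Pow (S - {p})"
    and cov: "\<And>C d. C \<in> A \<Longrightarrow> d \<in> K \<Longrightarrow> d = p \<or> Suc d = p \<Longrightarrow> d \<in> C \<or> Suc d \<in> C"
  shows "cover_char_poly S K =
    [:0, 1:] ^ (2 * card A) * set_char_poly (Pow S - A - insert p ` A) (cover_entry K)"
  unfolding cover_char_poly_def
proof (rule set_char_poly_isotropic_pairs[where c = \<i>])
  show "inj_on (insert p) A"
    using A by (intro inj_onI) blast
  have *: "finite C \<and> p \<notin> C" if "C \<in> A" for C
    using that A fin by (auto intro: finite_subset)
  show "cover_entry K (insert p a) y = \<i> * cover_entry K a y" if "a \<in> A" for a y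
    using cover_entry_insert_covered(1)[of a p K] * cov that by blast
  show "cover_entry K x (insert p a) = \<i> * cover_entry K x a" if "a \<in> A" for a x
    using cover_entry_insert_covered(2)[of a p K] * cov that by blast
qed (use fin p A in auto)

text \<open>
  Sets that contain \<open>Suc p\<close> cover \<open>p\<close> without the help of \<open>p\<close>, and \<open>p - 1\<close> does not have to be
  covered; so these sets cancel in pairs.
\<close>
lemma cover_char_poly_remove_next:
  assumes fin: "finite S" and p: "p \<in> S" "Suc p \<in> S" and K: "\<And>d. d \<in> K \<Longrightarrow> Suc d \<noteq> p"
  shows "\<exists>a. cover_char_poly S K = [:0, 1:] ^ a * cover_char_poly (S - {Suc p}) K"
proof -
  let ?A = "{C. C \<subseteq> S - {p} \<and> Suc p \<in> C}"
  have "cover_char_poly S K =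
      [:0, 1:] ^ (2 * card ?A) * set_char_poly (Pow S - ?A - insert p ` ?A) (cover_entry K)"
    by (rule cover_char_poly_reduce) (use fin p K in auto)
  moreover have "Pow S - ?A - insert p ` ?A = Pow (S - {Suc p})"
  proof -
    \<comment> \<open>the pairs exhaust the subsets of \<open>S\<close> that contain \<open>Suc p\<close>\<close>
    have "C \<in> ?A \<union> insert p ` ?A" if "C \<subseteq> S" "Suc p \<in> C" for C
    proof (cases "p \<in> C")
      case True
      then have "C = insert p (C - {p})" "C - {p} \<in> ?A" using that by auto
      then show ?thesis by blast
    qed (use that in auto)
    then show ?thesis by auto
  qed
  ultimately show ?thesis
    unfolding cover_char_poly_def by metis
qed

text \<open>
  If \<open>p\<close> covers no element of \<open>K\<close>, then all index sets cancel in pairs.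
\<close>
lemma cover_char_poly_free:
  assumes fin: "finite S" and p: "p \<in> S" and K: "\<And>d. d \<in> K \<Longrightarrow> d \<noteq> p \<and> Suc d \<noteq> p"
  shows "\<exists>a. cover_char_poly S K = [:0, 1:] ^ a"
proof -
  let ?A = "Pow (S - {p})"
  have "Pow S = Pow (S - {p}) \<union> insert p ` Pow (S - {p})"
    using p Pow_insert[of p "S - {p}"] by (simp add: insert_absorb)
  then have "Pow S - ?A - insert p ` ?A = {}" by blast
  then have "cover_char_poly S K = [:0, 1:] ^ (2 * card ?A) * set_char_poly {} (cover_entry K)"
    using cover_char_poly_reduce[OF fin p order.refl, of K] K by metis
  then show ?thesis
    using set_char_poly_zero[of "{}" "cover_entry K"] by auto
qed

lemma cover_char_poly_uncoverable:
  assumes "finite S" "d \<in> K" "d \<notin> S" "Suc d \<notin> S"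
  shows "cover_char_poly S K = [:0, 1:] ^ 2 ^ card S"
proof -
  have "cover_entry K C D = 0" if "C \<in> Pow S" "D \<in> Pow S" for C D
    using assms that by (auto simp: cover_entry_def covers_def)
  then show ?thesis
    unfolding cover_char_poly_def using assms(1)
    by (subst set_char_poly_zero) (simp_all add: card_Pow)
qed

text \<open>
  If the element \<open>d\<close> of \<open>K\<close> can be covered only by \<open>p\<close>, then \<open>p \<in> C \<union> D\<close> is necessary for a
  nonzero entry, and everything that \<open>p\<close> covers can be dropped from \<open>K\<close>. Ordering the index sets by
  whether they contain \<open>p\<close>, this gives the block form \<open>[[0, \<i> M], [\<i> M, - M]]\<close>, the two off-diagonal
  blocks having one factor \<open>\<i>\<close> for \<open>p\<close> and the last one having two.
\<close>
lemma poly_cover_char_poly_peel: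
  fixes \<omega> :: complex
  assumes \<omega>: "\<omega>\<^sup>2 + \<omega> + 1 = 0" and fin: "finite S" and p: "p \<in> S"
    and d: "d \<in> K" "d = p \<or> Suc d = p" "d \<notin> S - {p}" "Suc d \<notin> S - {p}"
    and K': "K' = {e \<in> K. e \<noteq> p \<and> Suc e \<noteq> p}"
  shows "poly (cover_char_poly S K) x =
    poly (cover_char_poly (S - {p}) K') (\<omega> * x) * poly (cover_char_poly (S - {p}) K') (\<omega>\<^sup>2 * x)"
proof -
  let ?J = "Pow (S - {p})"
  have J: "finite C \<and> p \<notin> C" if "C \<in> ?J" for C
    using that fin by (auto intro: finite_subset)
  have S: "Pow S = ?J \<union> insert p ` ?J"
    using p Pow_insert[of p "S - {p}"] by (simp add: insert_absorb)
  have cov: "covers K (insert p X) \<longleftrightarrow> covers K' X" for X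
    using K' by (auto simp: covers_def)
  show ?thesis
    unfolding cover_char_poly_def S
  proof (rule poly_set_char_poly_kronecker[OF \<omega>])
    fix C D assume CD: "C \<in> ?J" "D \<in> ?J"
    show "cover_entry K C D = 0"
      using d CD by (auto simp: cover_entry_def covers_def)
    show "cover_entry K C (insert p D) = \<i> * cover_entry K' C D"
      "cover_entry K (insert p C) D = \<i> * cover_entry K' C D"
      "cover_entry K (insert p C) (insert p D) = - cover_entry K' C D"
      using J[OF CD(1)] J[OF CD(2)] by (simp_all add: cover_entry_def cov)
  qed (use fin in \<open>auto simp: inj_on_def\<close>)
qed

lemma cover_char_poly_shift:
  assumes "finite S"
  shows "cover_char_poly ((\<lambda>x. x + t) ` S) ((\<lambda>x. x + t) ` K) = cover_char_poly S K"
proof -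
  let ?s = "\<lambda>x::nat. x + t"
  have inj: "inj ?s" by (simp add: inj_def)
  have "Pow (?s ` S) = image ?s ` Pow S"
    by (simp add: image_Pow_surj)
  then have "cover_char_poly (?s ` S) (?s ` K) =
      set_char_poly (Pow S) (\<lambda>C D. cover_entry (?s ` K) (?s ` C) (?s ` D))"
    unfolding cover_char_poly_def
    using assms inj by (simp add: set_char_poly_image inj_on_def inj_image_eq_iff)
  also have "\<dots> = cover_char_poly S K"
  proof -
    have *: "x + t \<in> ?s ` X \<longleftrightarrow> x \<in> X" "Suc (x + t) \<in> ?s ` X \<longleftrightarrow> Suc x \<in> X" for x X
      by (auto simp: image_iff simp flip: add_Suc)
    have "covers (?s ` K) (?s ` C \<union> ?s ` D) \<longleftrightarrow> covers K (C \<union> D)" for C D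
      by (simp add: covers_def * flip: image_Un)
    moreover have "card (?s ` X) = card X" for X
      by (intro card_image) (simp add: inj_on_def)
    ultimately show ?thesis
      by (simp only: cover_char_poly_def cover_entry_def[abs_def])
  qed
  finally show ?thesis .
qed

section \<open>The recursion for the multiplicities\<close>

text \<open>
  The pair \<open>m\<close> contains the multiplicity of the root 1 and that of each of the two primitive cube
  roots of unity. The multiplicity of 0 is left open, since it is determined by the degree.
\<close>
definition root_pattern :: "complex poly \<Rightarrow> nat \<times> nat \<Rightarrow> bool" where
  "root_pattern p m \<longleftrightarrow> (\<exists>a. p = [:0, 1:] ^ a * [:-1, 1:] ^ fst m * [:1, 1, 1:] ^ snd m)"

lemma root_pattern_nilpotent: "root_pattern ([:0, 1:] ^ a) (0, 0)"
  by (auto simp: root_pattern_def)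

lemma root_pattern_power_mult:
  assumes "root_pattern q m" "p = [:0, 1:] ^ a * q"
  shows "root_pattern p m"
proof -
  obtain b where "q = [:0, 1:] ^ b * [:-1, 1:] ^ fst m * [:1, 1, 1:] ^ snd m"
    using assms(1) by (auto simp: root_pattern_def)
  then have "p = [:0, 1:] ^ (a + b) * [:-1, 1:] ^ fst m * [:1, 1, 1:] ^ snd m"
    using assms(2) by (simp only: power_add mult.assoc)
  then show ?thesis by (auto simp: root_pattern_def)
qed

lemma exp_third_root:
  fixes j :: complex
  assumes "j = exp (2 * \<i> * of_real pi / 3)"
  shows "j\<^sup>2 + j + 1 = 0"
proof -
  have "j = cis (2 * pi / 3)"
    unfolding assms cis_conv_exp by (rule arg_cong[of _ _ exp]) simp
  then have j: "j = Complex (- 1 / 2) (sqrt 3 / 2)"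
    by (simp add: complex_eq_iff cos_120 sin_120)
  show ?thesis
    unfolding j by (simp add: complex_eq_iff power2_eq_square)
qed

text \<open>
  Multiplication by \<open>\<omega>\<close> and \<open>\<omega>\<^sup>2\<close> sends a root 1 to one copy of each primitive cube root, and
  a pair of primitive cube roots to two copies of 1 and one copy of each primitive cube root.
\<close>
lemma root_pattern_peel:
  assumes q: "root_pattern q (u, v)"
    and p: "\<And>\<omega> x. \<omega>\<^sup>2 + \<omega> + 1 = 0 \<Longrightarrow> poly p x = poly q (\<omega> * x) * poly q (\<omega>\<^sup>2 * x)"
  shows "root_pattern p (2 * v, u + v)"
proof -
  obtain \<omega> :: complex where \<omega>: "\<omega>\<^sup>2 + \<omega> + 1 = 0"
    using exp_third_root by blast
  obtain a where a: "q = [:0, 1:] ^ a * [:-1, 1:] ^ u * [:1, 1, 1:] ^ v"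
    using q by (auto simp: root_pattern_def)
  have "poly p x = poly ([:0, 1:] ^ (2 * a) * [:-1, 1:] ^ (2 * v) * [:1, 1, 1:] ^ (u + v)) x" for x
  proof -
    have "poly p x = ((\<omega> * x) * (\<omega>\<^sup>2 * x)) ^ a * ((\<omega> * x - 1) * (\<omega>\<^sup>2 * x - 1)) ^ u *
        ((1 + \<omega> * x * (1 + \<omega> * x)) * (1 + \<omega>\<^sup>2 * x * (1 + \<omega>\<^sup>2 * x))) ^ v"
      unfolding p[OF \<omega>] a by (simp add: power_mult_distrib)
    then show ?thesis
      unfolding cube_root_of_unity_norms[OF \<omega>] by (simp add: power_mult_distrib power_add flip: power_mult)
  qed
  then have "p = [:0, 1:] ^ (2 * a) * [:-1, 1:] ^ (2 * v) * [:1, 1, 1:] ^ (u + v)"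
    by (intro poly_eq_poly_eq_iff[THEN iffD1] ext)
  then show ?thesis by (auto simp: root_pattern_def)
qed

fun peel_mult :: "nat \<times> nat \<Rightarrow> nat \<times> nat" where
  "peel_mult (u, v) = (2 * v, u + v)"

lemma root_pattern_cover_peel:
  assumes "root_pattern (cover_char_poly S' K') m"
    and "S' = S - {p}" "K' = {e \<in> K. e \<noteq> p \<and> Suc e \<noteq> p}"
    and "finite S" "p \<in> S" "d \<in> K" "d = p \<or> Suc d = p" "d \<notin> S'" "Suc d \<notin> S'"
  shows "root_pattern (cover_char_poly S K) (peel_mult m)"
proof (cases m)
  case (Pair u v)
  then show ?thesis
    using root_pattern_peel[of _ u v] poly_cover_char_poly_peel[of _ S p d K K'] assms
    by simp
qed

lemma root_pattern_remove_next:
  assumes "root_pattern (cover_char_poly S' K) m" and "S' = S - {Suc p}"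
    and "finite S" "p \<in> S" "Suc p \<in> S" "\<And>d. d \<in> K \<Longrightarrow> Suc d \<noteq> p"
  shows "root_pattern (cover_char_poly S K) m"
  using cover_char_poly_remove_next[OF assms(3-6)] root_pattern_power_mult assms(1,2) by blast

text \<open>
  The matrix with a single index, the empty set, and nothing to cover is the identity.
\<close>
lemma root_pattern_empty: "root_pattern (cover_char_poly {} {}) (1, 0)"
proof -
  have "cover_char_poly {} {} = char_poly (list_mat [{}] (cover_entry {}))"
    unfolding cover_char_poly_def using set_char_poly_list[of "[{}]"] by simp
  also have "\<dots> = [:-1, 1:]"
    by (subst char_poly_upper_triangular[of _ 1])
       (auto simp: list_mat_def diag_mat_def cover_entry_def covers_def)
  finally show ?thesis
    unfolding root_pattern_def by (intro exI[of _ 0]) simp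
qed

text \<open>
  The recursion from \<open>R_N\<close> to \<open>R_(N-6)\<close>. Element 2 is removed from the index sets by pairing with
  element 1. Then 1 can be covered only by 1, and 2 only by 3; as 3 covers 3 as well, peeling off 1 and 3
  leaves the elements from 4 on, both for the index sets and for the set to be covered. For \<open>k = 2\<close>
  truncated subtraction gives the intended empty set.
\<close>
lemma root_pattern_cover_step:
  assumes h: "3 \<le> h" and k: "2 \<le> k"
    and IH: "root_pattern (cover_char_poly {1..h - 3} {1..k - 3}) m"
  shows "root_pattern (cover_char_poly {1..h} {1..k}) (peel_mult (peel_mult m))"
proof -
  have shift: "(\<lambda>x. x + 3) ` {1..n - 3} = {4..n}" for n :: nat
    by (cases "n < 4") simp_all
  have "root_pattern (cover_char_poly {4..h} {4..k}) m"
    using IH cover_char_poly_shift[of "{1..h - 3}" 3 "{1..k - 3}"]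
    unfolding shift by simp
  then have "root_pattern (cover_char_poly {3..h} {2..k}) (peel_mult m)"
    by (rule root_pattern_cover_peel[where p = 3 and d = 2]) (use h k in auto)
  then have "root_pattern (cover_char_poly ({1..h} - {2}) {1..k}) (peel_mult (peel_mult m))"
    by (rule root_pattern_cover_peel[where p = 1 and d = 1]) (use h k in auto)
  then show ?thesis
    by (rule root_pattern_remove_next[where p = 1]) (use h in auto)
qed

text \<open>
  The multiplicities after \<open>n\<close> Kronecker factors \<open>[[0, \<i>], [\<i>, -1]]\<close>, starting from the identity
  matrix of size 1.
\<close>
definition root_mult :: "nat \<Rightarrow> nat \<times> nat" where
  "root_mult n = (peel_mult ^^ n) (1, 0)"

lemma root_mult_closed_form:
  "3 * int (fst (root_mult n)) = 2 ^ n + 2 * (-1) ^ n \<and>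
   3 * int (snd (root_mult n)) = 2 ^ n - (-1) ^ n"
proof (induction n)
  case (Suc n)
  obtain u v where uv: "root_mult n = (u, v)" by (cases "root_mult n")
  then have "root_mult (Suc n) = (2 * v, u + v)" by (simp add: root_mult_def)
  then show ?case using Suc uv by simp
qed (simp add: root_mult_def)

text \<open>
  The case \<open>N = 5\<close> also falls under the recursion: it leads to the identity matrix of size 1, which is
  the case \<open>N = 0\<close>, just as \<open>N - 6\<close> says in truncated subtraction.
\<close>
lemma root_pattern_cover_char_poly:
  "root_pattern (cover_char_poly {1..(N + 1) div 2} {1..N div 2})
    (if N mod 3 = 1 then (0, 0) else root_mult ((N + 2) div 3))"
proof (induction N rule: less_induct)
  case (less N)
  have one: "{1..1} = {1::nat}" "{1..2} = {1, 2::nat}" "{Suc 0..2} = {Suc 0, 2}" by auto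
  have rm1: "root_mult 1 = peel_mult (1, 0)" by (simp add: root_mult_def)
  have nilp: "root_pattern p (0, 0)" if "\<exists>a. p = [:0, 1:] ^ a" for p
    using that root_pattern_nilpotent by blast
  have one_one: "root_pattern (cover_char_poly {1} {1}) (root_mult 1)"
    unfolding rm1 by (rule root_pattern_cover_peel[OF root_pattern_empty, where p = 1 and d = 1]) auto
  consider "N = 0" | "N = 1" | "N = 2" | "N = 3" | "N = 4" | "5 \<le> N" by linarith
  then show ?case
  proof cases
    case 1
    then show ?thesis using root_pattern_empty by (simp add: root_mult_def)
  next
    case 2
    have "root_pattern (cover_char_poly {1} {}) (0, 0)"
      by (rule nilp[OF cover_char_poly_free[of _ 1]]) auto
    then show ?thesis using 2 by simp
  next
    case 3
    then show ?thesis using one_one by simp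
  next
    case 4
    have "root_pattern (cover_char_poly {1, 2} {1}) (root_mult 1)"
      by (rule root_pattern_remove_next[OF one_one, where p = 1]) auto
    then show ?thesis using 4 by (simp add: one)
  next
    case 5
    have "root_pattern (cover_char_poly {1} {1, 2}) (0, 0)"
      by (rule nilp) (use cover_char_poly_uncoverable[of "{1}" 2 "{1, 2}"] in auto)
    then have "root_pattern (cover_char_poly {1, 2} {1, 2}) (0, 0)"
      by (rule root_pattern_remove_next[where p = 1]) auto
    then show ?thesis using 5 by (simp add: one)
  next
    case 6
    define M where "M = N - 6"
    have hk: "(N + 1) div 2 - 3 = (M + 1) div 2" "N div 2 - 3 = M div 2"
      using 6 by (auto simp: M_def)
    have "root_pattern (cover_char_poly {1..(M + 1) div 2} {1..M div 2})
        (if M mod 3 = 1 then (0, 0) else root_mult ((M + 2) div 3))"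
      by (rule less.IH) (use 6 in \<open>simp add: M_def\<close>)
    then have "root_pattern (cover_char_poly {1..(N + 1) div 2} {1..N div 2})
        (peel_mult (peel_mult (if M mod 3 = 1 then (0, 0) else root_mult ((M + 2) div 3))))"
      unfolding hk[symmetric] by (rule root_pattern_cover_step[rotated 2]) (use 6 in auto)
    moreover have "N mod 3 = 1 \<longleftrightarrow> M mod 3 = 1" "(N + 2) div 3 = Suc (Suc ((M + 2) div 3))"
    proof -
      have shift: "(M + 6) mod 3 = M mod 3" "(M + 6 + 2) div 3 = Suc (Suc ((M + 2) div 3))"
        by presburger+
      have "N = 5 \<and> M = 0 \<or> N = M + 6" using 6 by (auto simp: M_def)
      then show "N mod 3 = 1 \<longleftrightarrow> M mod 3 = 1" "(N + 2) div 3 = Suc (Suc ((M + 2) div 3))"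
        using shift by (elim disjE; simp)+
    qed
    ultimately show ?thesis
      by (cases "M mod 3 = 1") (simp_all add: root_mult_def)
  qed
qed

section \<open>Nilpotent matrices and multiplicities of roots\<close>

lemma diag_block_mat_zero:
  assumes "\<And>B. B \<in> set Bs \<Longrightarrow> B = 0\<^sub>m (dim_row B) (dim_col B)"
  shows "diag_block_mat Bs = 0\<^sub>m (sum_list (map dim_row Bs)) (sum_list (map dim_col Bs))"
  using assms
proof (induction Bs)
  case (Cons B Bs)
  have B: "B = 0\<^sub>m (dim_row B) (dim_col B)"
    and IH: "diag_block_mat Bs = 0\<^sub>m (sum_list (map dim_row Bs)) (sum_list (map dim_col Bs))"
    using Cons by auto
  have "B $$ (i, j) = 0" if "i < dim_row B" "j < dim_col B" for i j
    using that by (subst B) simp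
  then show ?case
    by (intro eq_matI) (auto simp: Let_def IH)
qed auto

text \<open>
  All Jordan blocks have eigenvalue 0 and size at most \<open>n\<close>, so their \<open>n\<close>-th powers vanish.
\<close>
lemma nilpotent_of_char_poly:
  fixes A :: "complex mat"
  assumes A: "A \<in> carrier_mat n n" and cp: "char_poly A = [:0, 1:] ^ n"
  shows "A ^\<^sub>m n = 0\<^sub>m n n"
proof -
  have "char_poly A = (\<Prod>a\<leftarrow>replicate n 0. [:- a, 1:])" using cp by simp
  then obtain bs where jnf: "jordan_nf A bs"
    using jordan_nf_exists[OF A] by blast
  obtain P Q where PQ: "P \<in> carrier_mat n n" "Q \<in> carrier_mat n n"
    and pow: "\<And>k. A ^\<^sub>m k = P * (jordan_matrix bs) ^\<^sub>m k * Q"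
    using jordan_nf_powE[OF A jnf] by metis
  have block: "jordan_block m a ^\<^sub>m n = 0\<^sub>m m m" if "(m, a) \<in> set bs" for m a
  proof -
    have "m \<noteq> 0" using jnf that by (force simp: jordan_nf_def)
    moreover have "m \<le> order a ([:- 0, 1:] ^ n)"
      using jordan_nf_block_size_order_bound[OF jnf that] by (simp add: cp)
    ultimately have "a = 0" "m \<le> n"
      unfolding order_linear_power by (auto split: if_splits)
    then show ?thesis
      by (intro eq_matI) (auto simp: jordan_block_zero_pow)
  qed
  obtain m where m: "A \<in> carrier_mat m m" "jordan_matrix bs \<in> carrier_mat m m"
    using jnf unfolding jordan_nf_def by (blast dest: similar_matD)
  have dims: "sum_list (map fst bs) = n"
    using carrier_matD(1)[OF m(1)] carrier_matD(1)[OF m(2)] carrier_matD(1)[OF A]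
    by (simp only: jordan_matrix_dim)
  let ?Bs = "map (\<lambda>(m, a). jordan_block m a ^\<^sub>m n) bs"
  have "map dim_row ?Bs = map fst bs" "map dim_col ?Bs = map fst bs"
    by (auto simp: case_prod_unfold)
  moreover have "B = 0\<^sub>m (dim_row B) (dim_col B)" if B: "B \<in> set ?Bs" for B
  proof -
    obtain k a where "(k, a) \<in> set bs" "B = jordan_block k a ^\<^sub>m n"
      using B by auto
    then show ?thesis by (simp add: block)
  qed
  ultimately have "jordan_matrix bs ^\<^sub>m n = 0\<^sub>m n n"
    unfolding jordan_matrix_pow by (subst diag_block_mat_zero) (simp_all only: dims)
  then show ?thesis unfolding pow using PQ by simp
qed

section \<open>The transfer matrix\<close>

lemma nat_ceiling_half: "nat \<lceil>real N / 2\<rceil> = (N + 1) div 2"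
  by linarith

lemma nat_floor_half: "nat \<lfloor>real N / 2\<rfloor> = N div 2"
  by linarith

lemma nat_ceiling_third: "nat \<lceil>real N / 3\<rceil> = (N + 2) div 3"
  by linarith

lemma R_entry_eq_cover_entry: "R_entry N = cover_entry {1..N div 2}"
proof (intro ext)
  fix C D :: "nat set"
  \<comment> \<open>truncated subtraction sends both 0 and 1 to 0, but \<open>d\<close> is positive\<close>
  have "d \<in> (\<lambda>c. c - 1) ` X \<longleftrightarrow> Suc d \<in> X" if "d \<in> {1..N div 2}" for d X
    using that by (force simp: image_iff)
  then have "{1..N div 2} \<subseteq> C \<union> D \<union> (\<lambda>c. c - 1) ` C \<union> (\<lambda>d. d - 1) ` D \<longleftrightarrow>
      covers {1..N div 2} (C \<union> D)"
    unfolding covers_def subset_iff by blast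
  then show "R_entry N C D = cover_entry {1..N div 2} C D"
    by (simp only: R_entry_def cover_entry_def nat_floor_half)
qed

lemma R_mat_carrier: "R_mat N \<in> carrier_mat (2 ^ ((N + 1) div 2)) (2 ^ ((N + 1) div 2))"
  unfolding R_mat_def Let_def nat_ceiling_half by simp

lemma char_poly_R_mat:
  "char_poly (R_mat N) = cover_char_poly {1..(N + 1) div 2} {1..N div 2}"
proof -
  let ?xs = "map subset_of [0..<2 ^ ((N + 1) div 2)]"
  have bij: "bij_betw subset_of {0..<2 ^ ((N + 1) div 2)} (Pow {1..(N + 1) div 2})"
    using bij_betw_subset_of by (simp only: atLeast0LessThan)
  have "R_mat N = list_mat ?xs (cover_entry {1..N div 2})"
    unfolding R_mat_def Let_def nat_ceiling_half list_mat_def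
    by (rule eq_matI) (auto simp: R_entry_eq_cover_entry)
  moreover have "distinct ?xs" "set ?xs = Pow {1..(N + 1) div 2}"
    using bij by (auto simp: distinct_map bij_betw_def)
  ultimately show ?thesis
    unfolding cover_char_poly_def by (metis set_char_poly_list)
qed

lemma quadratic_factor:
  fixes j :: complex
  assumes "j\<^sup>2 + j + 1 = 0"
  shows "[:1, 1, 1:] = [:- j, 1:] * [:- (j\<^sup>2), 1:]"
proof -
  have prod: "j * j\<^sup>2 = 1" and sum: "j + j\<^sup>2 = - 1"
    using cube_root_of_unity_norms(1,2)[OF assms, of 1] by simp_all
  have "- (j\<^sup>2) - j = - (j + j\<^sup>2)" by simp
  also have "\<dots> = 1" by (simp only: sum minus_minus)
  finally show ?thesis
    using prod by (simp add: mult.commute)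
qed

lemma order_root_pattern:
  fixes j :: complex
  assumes j: "j\<^sup>2 + j + 1 = 0"
    and p: "p = [:0, 1:] ^ a * [:-1, 1:] ^ u * [:1, 1, 1:] ^ v"
  shows "order 0 p = a" "order 1 p = u" "order j p = v" "order (j\<^sup>2) p = v"
proof -
  have "j \<noteq> 0" "j \<noteq> 1" "j \<noteq> - 1"
    using j by (auto simp: power2_eq_square)
  then have ne: "j \<noteq> 0" "j \<noteq> 1" "j\<^sup>2 \<noteq> 0" "j\<^sup>2 \<noteq> 1" "j\<^sup>2 \<noteq> j"
    by (auto simp: power2_eq_square square_eq_1_iff)
  have "order z p = (if z = 0 then a else 0) + (if z = 1 then u else 0) +
      (if z = j then v else 0) + (if z = j\<^sup>2 then v else 0)" for z
  proof -
    have "p = [:- 0, 1:] ^ a * [:- 1, 1:] ^ u * [:- j, 1:] ^ v * [:- (j\<^sup>2), 1:] ^ v"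
      unfolding p quadratic_factor[OF j] power_mult_distrib by (simp add: mult.assoc)
    then show ?thesis
      by (simp add: order_mult order_linear_power del: minus_zero)
  qed
  then show "order 0 p = a" "order 1 p = u" "order j p = v" "order (j\<^sup>2) p = v"
    using ne by auto
qed

lemma degree_root_pattern:
  "degree ([:0, 1:] ^ a * [:-1, 1:] ^ u * [:1, 1, 1:] ^ v :: complex poly) = a + u + 2 * v"
  by (simp add: degree_mult_eq degree_power_eq)

theorem theorem9:
  fixes N n :: nat and j :: complex
  assumes "N \<ge> 1"
    and "n = nat \<lceil>real N / 3\<rceil>"
    and "j = exp (2 * \<i> * of_real pi / 3)"
  shows "R_mat N \<in> carrier_mat (2 ^ nat \<lceil>real N / 2\<rceil>) (2 ^ nat \<lceil>real N / 2\<rceil>) \<and>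
    (N mod 3 = 1 \<longrightarrow>
       (\<exists>k. R_mat N ^\<^sub>m k = 0\<^sub>m (2 ^ nat \<lceil>real N / 2\<rceil>) (2 ^ nat \<lceil>real N / 2\<rceil>)) \<and>
       (\<forall>ev. eigenvalue (R_mat N) ev \<longrightarrow> ev = 0)) \<and>
    (N mod 3 \<noteq> 1 \<longrightarrow>
       (\<forall>ev. eigenvalue (R_mat N) ev \<longrightarrow> ev \<in> {0, 1, j, j\<^sup>2}) \<and>
       real (order 0 (char_poly (R_mat N))) = 2 ^ nat \<lceil>real N / 2\<rceil> - 2 ^ n \<and>
       real (order 1 (char_poly (R_mat N))) = (2 ^ n + 2 * (-1) ^ n) / 3 \<and>
       real (order j (char_poly (R_mat N))) = (2 ^ n - (-1) ^ n) / 3 \<and>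
       real (order (j\<^sup>2) (char_poly (R_mat N))) = (2 ^ n - (-1) ^ n) / 3)"
proof -
  let ?s = "2 ^ ((N + 1) div 2) :: nat"
  let ?p = "char_poly (R_mat N)"
  have n: "n = (N + 2) div 3" using assms(2) by (simp only: nat_ceiling_third)
  have j: "j\<^sup>2 + j + 1 = 0" by (rule exp_third_root[OF assms(3)])
  note A = R_mat_carrier[of N]
  obtain u v where uv: "(u, v) = (if N mod 3 = 1 then (0, 0) else root_mult n)"
    by (metis surj_pair)
  have "root_pattern ?p (u, v)"
    unfolding uv char_poly_R_mat n by (rule root_pattern_cover_char_poly)
  then obtain a where p: "?p = [:0, 1:] ^ a * [:-1, 1:] ^ u * [:1, 1, 1:] ^ v"
    by (auto simp: root_pattern_def)
  have deg: "a + u + 2 * v = ?s"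
    using degree_monic_char_poly[OF A] unfolding p degree_root_pattern by blast
  have ev: "poly ?p ev = 0" if "eigenvalue (R_mat N) ev" for ev
    using that eigenvalue_root_char_poly[OF A] by blast
  show ?thesis
    unfolding nat_ceiling_half
  proof (intro conjI impI allI)
    show "R_mat N \<in> carrier_mat ?s ?s" by (rule A)
  next
    assume "N mod 3 = 1"
    then have "?p = [:0, 1:] ^ ?s"
      using uv p deg by simp
    then show "\<exists>k. R_mat N ^\<^sub>m k = 0\<^sub>m ?s ?s"
      using nilpotent_of_char_poly[OF A] by blast
    show "ev = 0" if "eigenvalue (R_mat N) ev" for ev
      using ev[OF that] \<open>?p = [:0, 1:] ^ ?s\<close> by simp
  next
    assume N: "N mod 3 \<noteq> 1"
    then have "3 * int u = 2 ^ n + 2 * (-1) ^ n \<and> 3 * int v = 2 ^ n - (-1) ^ n"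
      using uv root_mult_closed_form[of n] by (metis fst_conv snd_conv)
    then have "real_of_int (3 * int u) = real_of_int (2 ^ n + 2 * (-1) ^ n)"
      "real_of_int (3 * int v) = real_of_int (2 ^ n - (-1) ^ n)"
      by simp_all
    then have u: "real u = (2 ^ n + 2 * (-1) ^ n) / 3" and v: "real v = (2 ^ n - (-1) ^ n) / 3"
      by simp_all
    have "real a + real u + 2 * real v = real ?s"
      using arg_cong[OF deg, of real] by simp
    then have "real a = 2 ^ ((N + 1) div 2) - 2 ^ n"
      using u v by (simp add: field_simps)
    with u v show "real (order 0 ?p) = 2 ^ ((N + 1) div 2) - 2 ^ n"
      "real (order 1 ?p) = (2 ^ n + 2 * (-1) ^ n) / 3"
      "real (order j ?p) = (2 ^ n - (-1) ^ n) / 3"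
      "real (order (j\<^sup>2) ?p) = (2 ^ n - (-1) ^ n) / 3"
      using order_root_pattern[OF j p] by simp_all
    show "ev \<in> {0, 1, j, j\<^sup>2}" if "eigenvalue (R_mat N) ev" for ev
    proof -
      have "ev = 0 \<or> ev = 1 \<or> 1 + ev * (1 + ev) = 0"
        using ev[OF that] unfolding p by auto
      moreover have "1 + ev * (1 + ev) = (ev - j) * (ev - j\<^sup>2)"
        using arg_cong[OF quadratic_factor[OF j], of "\<lambda>q. poly q ev"]
        by (simp add: algebra_simps)
      ultimately show ?thesis by auto
    qed
  qed
qed

end
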